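(* Let $k=4$ and use the total order index set $I=\{(v,w)\in\mathbb{N}_0^2: v+w\le 4\}$ (15 modes). For real $q_0,\dots,q_5$ let $\tilde{\mathbf Q}$ be the symmetric $15\times 15$ real matrix indexed by $I$ whose only nonzero entries, up to the symmetry $\tilde Q_{a,b}=\tilde Q_{b,a}$, are $$\tilde Q_{(0,4),(0,4)}=\tilde Q_{(4,0),(4,0)}=q_0,\quad \tilde Q_{(1,3),(1,3)}=\tilde Q_{(3,1),(3,1)}=q_1,\quad \tilde Q_{(2,2),(2,2)}=q_2,$$ $$\tilde Q_{(0,4),(2,2)}=\tilde Q_{(2,2),(4,0)}=q_3,\quad \tilde Q_{(1,3),(3,1)}=q_4,\quad \tilde Q_{(0,4),(4,0)}=q_5 .$$ Then $\tilde{\mathbf Q}\tilde{\mathbf D}_x=-(\tilde{\mathbf Q}\tilde{\mathbf D}_x)^T$, $\tilde{\mathbf Q}\tilde{\mathbf D}_y=-(\tilde{\mathbf Q}\tilde{\mathbf D}_y)^T$, and $\tilde{\mathbf T}\tilde{\mathbf Q}=\tilde{\mathbf Q}\tilde{\mathbf T}$ for every rotation $\tilde{\mathbf T}$ of the reference square by a multiple of $\pi/2$. Moreover $\tilde{\mathbf M}+\tilde{\mathbf Q}$ is positive definite if and only if all of the following hold: $$q_0>-\tfrac49,\qquad q_1>-\tfrac4{21},\qquad 36q_0+225q_0q_2+100q_2-225q_3^2+16>0,\qquad (21q_1+4)^2-441q_4^2>0,$$ $$(9q_0-9q_5+4)\left[9q_0(25q_2+4)+25q_2(9q_5+4)+2(-225q_3^2+18q_5+8)\right]>0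 .$$
   Context: The reference element is $\hat K=[-1,1]^2$, and $\psi_n$ is the Legendre polynomial of degree $n$ normalised by $\psi_n(1)=1$. For a finite index set $I\subset\mathbb{N}_0^2$, the approximation space is spanned by the modes $\phi_{(v,w)}(x,y)=\psi_v(x)\psi_w(y)$, $(v,w)\in I$. Vectors and matrices are indexed by $I$, and a vector of coefficients $\tilde{\mathbf u}$ represents $\sum_{a\in I}\tilde u_a\phi_a$. The modal mass matrix is $\tilde M_{a,b}=\int_{\hat K}\phi_a\phi_b\,\mathrm{d}x\,\mathrm{d}y$. The matrices $\tilde{\mathbf D}_x,\tilde{\mathbf D}_y$ represent $\partial/\partial x,\partial/\partial y$ on coefficient vectors (the space is closed under both). The rotation matrices $\tilde{\mathbf T}$ represent, on coefficient vectors, the maps $p(x,y)\mapsto p(R(x,y))$ with $R$ the rotation by $\pi/2$, $\pi$ or $3\pi/2$ about the origin (the space is invariant under these). *)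

theory Defs
  imports "HOL-Analysis.Analysis" "HOL-Computational_Algebra.Polynomial"
begin

text \<open>Legendre polynomials by Rodrigues' formula; this is the normalisation with value 1 at 1.\<close>

definition legendre :: "nat \<Rightarrow> real poly" where
  "legendre n = smult (1 / (2 ^ n * fact n)) ((pderiv ^^ n) ([:-1, 0, 1:] ^ n))"

lemma legendre_upto_4:
  "legendre 0 = 1"
  "legendre 1 = [:0, 1:]"
  "legendre 2 = [:-1/2, 0, 3/2:]"
  "legendre 3 = [:0, -3/2, 0, 5/2:]"
  "legendre 4 = [:3/8, 0, -15/4, 0, 35/8:]"
  by (simp_all add: legendre_def eval_nat_numeral pderiv_pCons fact_numeral)

definition ref_square :: "(real \<times> real) set" where
  "ref_square = {-1..1} \<times> {-1..1}"

definition mode_fun :: "nat \<times> nat \<Rightarrow> real \<times> real \<Rightarrow> real" where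
  "mode_fun = (\<lambda>(v, w) (x, y). poly (legendre v) x * poly (legendre w) y)"

definition total_order_index :: "nat \<Rightarrow> (nat \<times> nat) set" where
  "total_order_index k = {(v, w). v + w \<le> k}"

lemma finite_total_order_index: "finite (total_order_index k)"
  by (rule finite_subset[of _ "{..k} \<times> {..k}"]) (auto simp: total_order_index_def)

text \<open>The index set for \<open>k = 4\<close> as a finite type, so that matrices over it are \<open>real ^ idx4 ^ idx4\<close>.\<close>

typedef idx4 = "total_order_index 4" morphisms pair_of Idx4
  by (rule exI[of _ "(0, 0)"]) (simp add: total_order_index_def)

instance idx4 :: finite
proof
  have "finite (Idx4 ` total_order_index 4)"
    by (simp add: finite_total_order_index)
  moreover have "(UNIV :: idx4 set) = Idx4 ` total_order_index 4"
    using type_definition.Abs_image[OF type_definition_idx4] by simp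
  ultimately show "finite (UNIV :: idx4 set)"
    by simp
qed

lemma card_idx4: "CARD(idx4) = 15"
proof -
  have "total_order_index 4 = Sigma {..4} (\<lambda>v. {..4 - v})"
    by (auto simp: total_order_index_def)
  also have "card \<dots> = 15"
    by (simp add: eval_nat_numeral)
  finally show ?thesis
    using type_definition.card[OF type_definition_idx4] by simp
qed

definition modal_expansion :: "real ^ idx4 \<Rightarrow> real \<times> real \<Rightarrow> real" where
  "modal_expansion u p = (\<Sum>a\<in>UNIV. u $ a * mode_fun (pair_of a) p)"

definition mass_matrix :: "real ^ idx4 ^ idx4" where
  "mass_matrix =
    (\<chi> a b. integral ref_square (\<lambda>p. mode_fun (pair_of a) p * mode_fun (pair_of b) p))"

definition represents ::
  "real ^ idx4 ^ idx4 \<Rightarrow> ((real \<times> real \<Rightarrow> real) \<Rightarrow> (real \<times> real \<Rightarrow> real)) \<Rightarrow> bool" where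
  "represents A L \<longleftrightarrow> (\<forall>u. modal_expansion (A *v u) = L (modal_expansion u))"

text \<open>Meaningful for linear operators that leave the span of the modes invariant; the modes are
  linearly independent, so the representing matrix is then unique.\<close>

definition matrix_of ::
  "((real \<times> real \<Rightarrow> real) \<Rightarrow> (real \<times> real \<Rightarrow> real)) \<Rightarrow> real ^ idx4 ^ idx4" where
  "matrix_of L = (THE A. represents A L)"

definition partial_x :: "(real \<times> real \<Rightarrow> real) \<Rightarrow> real \<times> real \<Rightarrow> real" where
  "partial_x f = (\<lambda>(x, y). deriv (\<lambda>t. f (t, y)) x)"

definition partial_y :: "(real \<times> real \<Rightarrow> real) \<Rightarrow> real \<times> real \<Rightarrow> real" where
  "partial_y f = (\<lambda>(x, y). deriv (\<lambda>t. f (x, t)) y)"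

definition Dx :: "real ^ idx4 ^ idx4" where
  "Dx = matrix_of partial_x"

definition Dy :: "real ^ idx4 ^ idx4" where
  "Dy = matrix_of partial_y"

definition rotation :: "real \<Rightarrow> real \<times> real \<Rightarrow> real \<times> real" where
  "rotation \<theta> = (\<lambda>(x, y). (cos \<theta> * x - sin \<theta> * y, sin \<theta> * x + cos \<theta> * y))"

definition rot_matrix :: "real \<Rightarrow> real ^ idx4 ^ idx4" where
  "rot_matrix \<theta> = matrix_of (\<lambda>p. p \<circ> rotation \<theta>)"

text \<open>The entry at \<open>(a, b)\<close> is read off from the unordered pair \<open>{a, b}\<close>, which makes the matrix
  symmetric; a singleton stands for a diagonal entry.\<close>

definition Q_entry ::
  "real \<Rightarrow> real \<Rightarrow> real \<Rightarrow> real \<Rightarrow> real \<Rightarrow> real \<Rightarrow> (nat \<times> nat) set \<Rightarrow> real" where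
  "Q_entry q0 q1 q2 q3 q4 q5 S =
    (if S = {(0, 4)} \<or> S = {(4, 0)} then q0
     else if S = {(1, 3)} \<or> S = {(3, 1)} then q1
     else if S = {(2, 2)} then q2
     else if S = {(0, 4), (2, 2)} \<or> S = {(2, 2), (4, 0)} then q3
     else if S = {(1, 3), (3, 1)} then q4
     else if S = {(0, 4), (4, 0)} then q5
     else 0)"

definition Q_matrix ::
  "real \<Rightarrow> real \<Rightarrow> real \<Rightarrow> real \<Rightarrow> real \<Rightarrow> real \<Rightarrow> real ^ idx4 ^ idx4" where
  "Q_matrix q0 q1 q2 q3 q4 q5 =
    (\<chi> a b. Q_entry q0 q1 q2 q3 q4 q5 {pair_of a, pair_of b})"

definition positive_definite :: "real ^ 'n ^ 'n \<Rightarrow> bool" where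
  "positive_definite A \<longleftrightarrow> transpose A = A \<and> (\<forall>x. x \<noteq> 0 \<longrightarrow> x \<bullet> (A *v x) > 0)"

end

theory Submission
  imports Defs
begin

text \<open>
  The rows and columns of the perturbation that are not zero belong to modes of total degree exactly 4,
  while differentiation lowers the degree, so its products with both derivative matrices vanish.
  The quarter turn sends the mode \<open>(v, w)\<close> to \<open>(-1)\<^sup>v\<close> times the mode \<open>(w, v)\<close>, which respects the
  symmetries of the entries, and all other rotations are its powers. By orthogonality the mass
  matrix is diagonal, so positive definiteness splits into a block on \<open>(0,4), (4,0), (2,2)\<close> and
  a block on \<open>(1,3), (3,1)\<close>.
\<close>

section \<open>Legendre orthogonality and the diagonal mass matrix\<close>

lemma has_integral_power_symmetric_Icc:
  "((\<lambda>x. x ^ k) has_integral (if even k then 2 / (real k + 1) else 0)) {-1..1::real}"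
proof -
  have "((\<lambda>x. x ^ k) has_integral (1 ^ Suc k / real (Suc k) - (-1) ^ Suc k / real (Suc k))) {-1..1::real}"
  proof (rule fundamental_theorem_of_calculus)
    fix x :: real
    have "((\<lambda>x. x ^ Suc k / real (Suc k)) has_real_derivative x ^ k) (at x within {-1..1})"
      by (rule derivative_eq_intros refl | simp)+
    then show "((\<lambda>x. x ^ Suc k / real (Suc k)) has_vector_derivative x ^ k) (at x within {-1..1})"
      by (simp add: has_real_derivative_iff_has_vector_derivative)
  qed simp
  then show ?thesis by (auto simp: add.commute split: if_splits)
qed

text \<open>Peels off the lowest coefficient and raises the exponent, so that rewriting alone
  integrates any concrete polynomial.\<close>

lemma integral_power_mult_pCons:
  fixes a :: real
  shows "integral {-1..1} (\<lambda>x. x ^ k * poly (pCons a p) x) =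
    a * (if even k then 2 / (real k + 1) else 0) + integral {-1..1} (\<lambda>x. x ^ Suc k * poly p x)"
proof -
  have "(\<lambda>x. x ^ k * poly (pCons a p) x) = (\<lambda>x. a * x ^ k + x ^ Suc k * poly p x)"
    by (auto simp: algebra_simps)
  moreover have "((\<lambda>x. a * x ^ k + x ^ Suc k * poly p x) has_integral
      a * (if even k then 2 / (real k + 1) else 0) + integral {-1..1} (\<lambda>x. x ^ Suc k * poly p x)) {-1..1}"
    by (intro has_integral_add has_integral_mult_right has_integral_power_symmetric_Icc integrable_integral
        integrable_continuous_real continuous_intros)
  ultimately show ?thesis by (simp only: integral_unique)
qed

lemma legendre_orthogonal_upto_4:
  assumes "v \<le> 4" "w \<le> 4"
  shows "integral {-1..1} (\<lambda>x. poly (legendre v) x * poly (legendre w) x) =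
    (if v = w then 2 / (2 * real v + 1) else 0)"
proof -
  define J :: "nat \<Rightarrow> real poly \<Rightarrow> real"
    where "J = (\<lambda>k p. integral {-1..1} (\<lambda>x. x ^ k * poly p x))"
  have J: "J k (pCons a p) = a * (if even k then 2 / (real k + 1) else 0) + J (Suc k) p"
    "J k 0 = 0" for k a p
    unfolding J_def by (rule integral_power_mult_pCons) simp
  have "v \<in> {0, 1, 2, 3, 4}" "w \<in> {0, 1, 2, 3, 4}" using assms by auto
  then have "J 0 (legendre v * legendre w) = (if v = w then 2 / (2 * real v + 1) else 0)"
    \<comment> \<open>The unfolding matches the simplifier's \<open>Suc 0\<close> and writes the
      constant polynomial 1 as a \<open>pCons\<close>, so that the rules \<open>J\<close> apply to
      it.\<close>
    by (auto simp: J legendre_upto_4[unfolded One_nat_def one_pCons])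
  then show ?thesis unfolding J_def poly_mult power_0 mult_1 .
qed

lemma continuous_on_mode_fun: "continuous_on S (mode_fun a)"
proof -
  have "mode_fun a = (\<lambda>p. poly (legendre (fst a)) (fst p) * poly (legendre (snd a)) (snd p))"
    by (auto simp: mode_fun_def split: prod.splits)
  then show ?thesis by (auto intro!: continuous_intros)
qed

lemma ref_square_eq: "ref_square = cbox (-1, -1) (1, 1)"
  by (simp add: ref_square_def cbox_Pair_eq)

lemma pair_of_le_4:
  "fst (pair_of a) \<le> 4" "snd (pair_of a) \<le> 4" "fst (pair_of a) + snd (pair_of a) \<le> 4"
  using pair_of[of a] by (auto simp: total_order_index_def)

text \<open>By Fubini the integral is a product of two one-dimensional Legendre integrals, each of
  which vanishes unless its two degrees agree.\<close>

lemma mass_matrix_nth: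
  "mass_matrix $ a $ b =
    (if a = b then 4 / ((2 * real (fst (pair_of a)) + 1) * (2 * real (snd (pair_of a)) + 1)) else 0)"
proof -
  obtain v w v' w' where vw: "pair_of a = (v, w)" "pair_of b = (v', w')"
    by fastforce
  have le: "v \<le> 4" "w \<le> 4" "v' \<le> 4" "w' \<le> 4"
    using pair_of_le_4[of a] pair_of_le_4[of b] vw by auto
  have "mass_matrix $ a $ b =
      integral (cbox (-1, -1) (1, 1)) (\<lambda>p. mode_fun (v, w) p * mode_fun (v', w') p)"
    by (simp add: mass_matrix_def vw ref_square_eq)
  also have "\<dots> = integral {-1..1} (\<lambda>x. integral {-1..1} (\<lambda>y.
      mode_fun (v, w) (x, y) * mode_fun (v', w') (x, y)))"
    by (subst integral_prod_continuous)
      (auto intro!: continuous_intros continuous_on_mode_fun)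
  also have "\<dots> = integral {-1..1} (\<lambda>x. integral {-1..1} (\<lambda>y.
      (poly (legendre v) x * poly (legendre v') x) * (poly (legendre w) y * poly (legendre w') y)))"
    by (simp add: mode_fun_def mult_ac)
  also have "\<dots> = integral {-1..1} (\<lambda>x. poly (legendre v) x * poly (legendre v') x)
      * integral {-1..1} (\<lambda>y. poly (legendre w) y * poly (legendre w') y)"
    by simp
  finally show ?thesis
    using vw by (auto simp: legendre_orthogonal_upto_4 le pair_of_inject[symmetric])
qed

section \<open>Uniqueness of coefficients and of representing matrices\<close>

lemma modal_expansion_coefficient:
  "integral ref_square (\<lambda>p. modal_expansion u p * mode_fun (pair_of b) p) =
    u $ b * mass_matrix $ b $ b"
proof -
  have "integral ref_square (\<lambda>p. modal_expansion u p * mode_fun (pair_of b) p) =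
      integral ref_square (\<lambda>p. \<Sum>a\<in>UNIV. u $ a * (mode_fun (pair_of a) p * mode_fun (pair_of b) p))"
    by (simp add: modal_expansion_def sum_distrib_right mult.assoc)
  also have "\<dots> = (\<Sum>a\<in>UNIV. u $ a * mass_matrix $ a $ b)"
    by (subst integral_sum)
      (auto simp: ref_square_eq mass_matrix_def
        intro!: integrable_continuous continuous_intros continuous_on_mode_fun)
  also have "\<dots> = u $ b * mass_matrix $ b $ b"
    by (simp add: mass_matrix_nth if_distrib[of "(*) _"] cong: if_cong)
  finally show ?thesis .
qed

text \<open>This is the linear independence of the modes: integrating against a mode returns its
  coefficient times a nonzero diagonal mass entry.\<close>

lemma modal_expansion_inject:
  assumes "modal_expansion u = modal_expansion u'"
  shows "u = u'"
proof -
  have "mass_matrix $ b $ b \<noteq> 0" for b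
    by (simp add: mass_matrix_nth add_eq_0_iff2)
  then show ?thesis
    using modal_expansion_coefficient[of u] modal_expansion_coefficient[of u'] assms
    by (simp add: vec_eq_iff)
qed

text \<open>Reduces the definite description in \<open>matrix_of\<close> to exhibiting one
  representing matrix.\<close>

lemma matrix_of_eqI:
  assumes "represents A L"
  shows "matrix_of L = A"
  unfolding matrix_of_def
proof (rule the_equality)
  show "represents A L" by (rule assms)
next
  fix B assume "represents B L"
  then have "B *v u = A *v u" for u
    using assms by (auto simp: represents_def intro: modal_expansion_inject)
  then show "B = A" by (simp add: matrix_eq)
qed

text \<open>Column \<open>b\<close> must hold the coefficients of the image of mode
  \<open>b\<close>. Linearity is asked only on modal expansions, since \<open>partial_x\<close> and
  \<open>partial_y\<close> are not linear on arbitrary functions.\<close>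

lemma representsI:
  assumes linear: "\<And>u p. L (modal_expansion u) p = (\<Sum>b\<in>UNIV. u $ b * L (mode_fun (pair_of b)) p)"
    and columns: "\<And>b p. L (mode_fun (pair_of b)) p = (\<Sum>a\<in>UNIV. A $ a $ b * mode_fun (pair_of a) p)"
  shows "represents A L"
proof -
  have "modal_expansion (A *v u) p = L (modal_expansion u) p" for u p
  proof -
    have "modal_expansion (A *v u) p =
        (\<Sum>a\<in>UNIV. \<Sum>b\<in>UNIV. u $ b * (A $ a $ b * mode_fun (pair_of a) p))"
      by (simp add: modal_expansion_def matrix_vector_mult_def sum_distrib_right sum_distrib_left mult_ac)
    also have "\<dots> = L (modal_expansion u) p"
      by (subst sum.swap) (simp add: linear columns sum_distrib_left)
    finally show ?thesis .
  qed
  then show ?thesis by (auto simp: represents_def)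
qed

section \<open>Sums over modes and the derivative matrices\<close>

lemma sum_pair_of: "(\<Sum>a\<in>UNIV. f (pair_of a)) = sum f (total_order_index 4)"
  by (rule sum.reindex_bij_witness[of _ Idx4 pair_of])
    (auto simp: pair_of pair_of_inverse Idx4_inverse)

text \<open>The coefficient of psi_v in the Legendre expansion of psi_w', as obtained by telescoping
  psi_{n+1}' - psi_{n-1}' = (2n+1) psi_n.\<close>

definition legendre_deriv_coeff :: "nat \<Rightarrow> nat \<Rightarrow> real" where
  "legendre_deriv_coeff v w = (if v < w \<and> odd (w - v) then 2 * real v + 1 else 0)"

text \<open>The upper limit \<open>n\<close> is free because a mode with one index equal to
  \<open>j\<close> leaves only the range up to \<open>4 - j\<close> for the other; the coefficients
  with \<open>v \<ge> w\<close> are 0.\<close>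

lemma pderiv_legendre_upto_4:
  assumes "w \<le> n" "n \<le> 4"
  shows "poly (pderiv (legendre w)) x = (\<Sum>v\<le>n. legendre_deriv_coeff v w * poly (legendre v) x)"
proof -
  have "w \<in> {0, 1, 2, 3, 4}" "n \<in> {0, 1, 2, 3, 4}" using assms by auto
  then show ?thesis using assms(1)
    by (auto simp: legendre_deriv_coeff_def atMost_nat_numeral atMost_Suc pderiv_pCons field_simps
        legendre_upto_4[unfolded One_nat_def])
qed

definition Dx_explicit :: "real ^ idx4 ^ idx4" where
  "Dx_explicit = (\<chi> a b. if snd (pair_of a) = snd (pair_of b)
    then legendre_deriv_coeff (fst (pair_of a)) (fst (pair_of b)) else 0)"

definition Dy_explicit :: "real ^ idx4 ^ idx4" where
  "Dy_explicit = (\<chi> a b. if fst (pair_of a) = fst (pair_of b)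
    then legendre_deriv_coeff (snd (pair_of a)) (snd (pair_of b)) else 0)"

lemma mode_fun_has_derivative_x:
  "((\<lambda>t. mode_fun (v, w) (t, y)) has_real_derivative
    poly (pderiv (legendre v)) x * poly (legendre w) y) (at x)"
  unfolding mode_fun_def by (auto intro!: derivative_eq_intros poly_DERIV)

lemma mode_fun_has_derivative_y:
  "((\<lambda>t. mode_fun (v, w) (x, t)) has_real_derivative
    poly (legendre v) x * poly (pderiv (legendre w)) y) (at y)"
  unfolding mode_fun_def by (auto intro!: derivative_eq_intros poly_DERIV)

lemma partial_x_mode_fun:
  "partial_x (mode_fun (v, w)) (x, y) = poly (pderiv (legendre v)) x * poly (legendre w) y"
  unfolding partial_x_def by (simp add: DERIV_imp_deriv[OF mode_fun_has_derivative_x])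

lemma partial_y_mode_fun:
  "partial_y (mode_fun (v, w)) (x, y) = poly (legendre v) x * poly (pderiv (legendre w)) y"
  unfolding partial_y_def by (simp add: DERIV_imp_deriv[OF mode_fun_has_derivative_y])

lemma partial_x_modal_expansion:
  "partial_x (modal_expansion u) p = (\<Sum>b\<in>UNIV. u $ b * partial_x (mode_fun (pair_of b)) p)"
proof -
  obtain x y where p: "p = (x, y)" by fastforce
  have "((\<lambda>t. mode_fun a (t, y)) has_real_derivative partial_x (mode_fun a) (x, y)) (at x)" for a
    by (cases a) (simp only: partial_x_mode_fun mode_fun_has_derivative_x)
  then have "((\<lambda>t. modal_expansion u (t, y)) has_real_derivative
      (\<Sum>b\<in>UNIV. u $ b * partial_x (mode_fun (pair_of b)) p)) (at x)"
    unfolding modal_expansion_def p by (intro DERIV_sum DERIV_cmult)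
  then show ?thesis unfolding p partial_x_def by (simp add: DERIV_imp_deriv)
qed

lemma partial_y_modal_expansion:
  "partial_y (modal_expansion u) p = (\<Sum>b\<in>UNIV. u $ b * partial_y (mode_fun (pair_of b)) p)"
proof -
  obtain x y where p: "p = (x, y)" by fastforce
  have "((\<lambda>t. mode_fun a (x, t)) has_real_derivative partial_y (mode_fun a) (x, y)) (at y)" for a
    by (cases a) (simp only: partial_y_mode_fun mode_fun_has_derivative_y)
  then have "((\<lambda>t. modal_expansion u (x, t)) has_real_derivative
      (\<Sum>b\<in>UNIV. u $ b * partial_y (mode_fun (pair_of b)) p)) (at y)"
    unfolding modal_expansion_def p by (intro DERIV_sum DERIV_cmult)
  then show ?thesis unfolding p partial_y_def by (simp add: DERIV_imp_deriv)
qed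

text \<open>Differentiating in x keeps the second index \<open>w\<close>, so column
  \<open>(v, w)\<close> only involves the modes \<open>(i, w)\<close> with
  \<open>i \<le> 4 - w\<close>, and the sum over all modes collapses to the expansion of the
  derivative of \<open>legendre v\<close>.\<close>

lemma Dx_eq: "Dx = Dx_explicit"
  unfolding Dx_def
proof (intro matrix_of_eqI representsI partial_x_modal_expansion)
  fix b :: idx4 and p :: "real \<times> real"
  obtain x y v w where p: "p = (x, y)" "pair_of b = (v, w)" by fastforce
  have le: "v \<le> 4 - w" "w \<le> 4" using pair_of_le_4[of b] p by auto
  have "(\<Sum>a\<in>UNIV. Dx_explicit $ a $ b * mode_fun (pair_of a) p) =
      (\<Sum>a\<in>total_order_index 4. if snd a = w
        then legendre_deriv_coeff (fst a) v * mode_fun a p else 0)"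
    by (subst sum_pair_of[symmetric]) (auto simp: Dx_explicit_def p intro!: sum.cong)
  also have "\<dots> = (\<Sum>a\<in>(\<lambda>i. (i, w)) ` {..4 - w}. legendre_deriv_coeff (fst a) v * mode_fun a p)"
    using le by (intro sum.mono_neutral_cong_right finite_total_order_index)
      (auto simp: total_order_index_def)
  also have "\<dots> = (\<Sum>i\<le>4 - w. legendre_deriv_coeff i v * mode_fun (i, w) p)"
    by (subst sum.reindex) (auto simp: inj_on_def)
  also have "\<dots> = partial_x (mode_fun (v, w)) p"
    using le unfolding p(1) partial_x_mode_fun
    by (simp add: pderiv_legendre_upto_4[of v "4 - w"] sum_distrib_left mode_fun_def mult_ac)
  finally show "partial_x (mode_fun (pair_of b)) p =
      (\<Sum>a\<in>UNIV. Dx_explicit $ a $ b * mode_fun (pair_of a) p)"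
    by (simp add: p)
qed

lemma Dy_eq: "Dy = Dy_explicit"
  unfolding Dy_def
proof (intro matrix_of_eqI representsI partial_y_modal_expansion)
  fix b :: idx4 and p :: "real \<times> real"
  obtain x y v w where p: "p = (x, y)" "pair_of b = (v, w)" by fastforce
  have le: "w \<le> 4 - v" "v \<le> 4" using pair_of_le_4[of b] p by auto
  have "(\<Sum>a\<in>UNIV. Dy_explicit $ a $ b * mode_fun (pair_of a) p) =
      (\<Sum>a\<in>total_order_index 4. if fst a = v
        then legendre_deriv_coeff (snd a) w * mode_fun a p else 0)"
    by (subst sum_pair_of[symmetric]) (auto simp: Dy_explicit_def p intro!: sum.cong)
  also have "\<dots> = (\<Sum>a\<in>Pair v ` {..4 - v}. legendre_deriv_coeff (snd a) w * mode_fun a p)"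
    using le by (intro sum.mono_neutral_cong_right finite_total_order_index)
      (auto simp: total_order_index_def)
  also have "\<dots> = (\<Sum>i\<le>4 - v. legendre_deriv_coeff i w * mode_fun (v, i) p)"
    by (subst sum.reindex) (auto simp: inj_on_def)
  also have "\<dots> = partial_y (mode_fun (v, w)) p"
    using le unfolding p(1) partial_y_mode_fun
    by (simp add: pderiv_legendre_upto_4[of w "4 - v"] sum_distrib_left mode_fun_def mult_ac)
  finally show "partial_y (mode_fun (pair_of b)) p =
      (\<Sum>a\<in>UNIV. Dy_explicit $ a $ b * mode_fun (pair_of a) p)"
    by (simp add: p)
qed

section \<open>Support of Q and its products with the derivative matrices\<close>

lemma Q_entry_support:
  assumes "Q_entry q0 q1 q2 q3 q4 q5 S \<noteq> 0" "a \<in> S" "b \<in> S"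
  shows "fst a + snd a = 4" "even (snd a) \<longleftrightarrow> even (snd b)"
proof -
  \<comment> \<open>These are the nine sets tested in \<open>Q_entry\<close>. In each of them all
    pairs have degree 4 and their second components share one parity.\<close>
  have "S \<in> {{(0, 4)}, {(4, 0)}, {(1, 3)}, {(3, 1)}, {(2, 2)}, {(0, 4), (2, 2)}, {(2, 2), (4, 0)},
      {(1, 3), (3, 1)}, {(0, 4), (4, 0)}}"
    using assms(1) unfolding Q_entry_def insert_iff by argo
  then show "fst a + snd a = 4" "even (snd a) \<longleftrightarrow> even (snd b)"
    using assms(2,3) by (elim insertE; auto)+
qed

lemma Q_entry_eq_0:
  assumes "fst a + snd a \<noteq> 4 \<or> fst b + snd b \<noteq> 4"
  shows "Q_entry q0 q1 q2 q3 q4 q5 {a, b} = 0"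
  using assms Q_entry_support(1)[of q0 q1 q2 q3 q4 q5 "{a, b}"] by blast

lemma Q_mult_Dx: "Q_matrix q0 q1 q2 q3 q4 q5 ** Dx = 0"
proof -
  have "Q_entry q0 q1 q2 q3 q4 q5 {pair_of a, pair_of c} * Dx $ c $ b = 0" for a b c
  proof (cases "fst (pair_of c) + snd (pair_of c) = 4")
    case True
    \<comment> \<open>A nonzero entry in row \<open>c\<close> of \<open>Dx\<close> needs a column
      with the same second index and a larger first one, hence of degree above 4.\<close>
    then show ?thesis
      using pair_of_le_4(3)[of b] by (simp add: Dx_eq Dx_explicit_def legendre_deriv_coeff_def)
  qed (simp add: Q_entry_eq_0)
  then show ?thesis
    by (auto simp: matrix_matrix_mult_def Q_matrix_def vec_eq_iff intro!: sum.neutral)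
qed

lemma Q_mult_Dy: "Q_matrix q0 q1 q2 q3 q4 q5 ** Dy = 0"
proof -
  have "Q_entry q0 q1 q2 q3 q4 q5 {pair_of a, pair_of c} * Dy $ c $ b = 0" for a b c
  proof (cases "fst (pair_of c) + snd (pair_of c) = 4")
    case True
    then show ?thesis
      using pair_of_le_4(3)[of b] by (simp add: Dy_eq Dy_explicit_def legendre_deriv_coeff_def)
  qed (simp add: Q_entry_eq_0)
  then show ?thesis
    by (auto simp: matrix_matrix_mult_def Q_matrix_def vec_eq_iff intro!: sum.neutral)
qed

section \<open>Rotations commute with Q\<close>

definition quarter_turn :: "real ^ idx4 ^ idx4" where
  "quarter_turn = (\<chi> a b. if pair_of a = prod.swap (pair_of b) then (-1) ^ fst (pair_of b) else 0)"

lemma poly_legendre_minus_upto_4: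
  assumes "v \<le> 4"
  shows "poly (legendre v) (- x) = (-1) ^ v * poly (legendre v) x"
  using assms legendre_upto_4 by (auto simp: numeral_eq_Suc le_Suc_eq)

lemma ex_pair_of_swap: "\<exists>b. pair_of b = prod.swap (pair_of a)"
  using pair_of[of a] by (intro exI[of _ "Idx4 (prod.swap (pair_of a))"] Idx4_inverse)
    (auto simp: total_order_index_def)

text \<open>The turn maps (x, y) to (-y, x), and psi_v(-y) psi_w(x) = (-1)^v psi_w(x) psi_v(y) by
  the parity of Legendre polynomials.\<close>

lemma represents_quarter_turn: "represents quarter_turn (\<lambda>f. f \<circ> rotation (pi / 2))"
proof (rule representsI)
  fix b :: idx4 and p :: "real \<times> real"
  obtain x y v w where p: "p = (x, y)" "pair_of b = (v, w)" by fastforce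
  obtain c where c: "pair_of c = prod.swap (pair_of b)" using ex_pair_of_swap by blast
  have "(\<Sum>a\<in>UNIV. quarter_turn $ a $ b * mode_fun (pair_of a) p) =
      (\<Sum>a\<in>UNIV. if a = c then (-1) ^ v * mode_fun (w, v) p else 0)"
    by (rule sum.cong) (use p c in \<open>auto simp: quarter_turn_def pair_of_inject[symmetric]\<close>)
  then show "(mode_fun (pair_of b) \<circ> rotation (pi / 2)) p =
      (\<Sum>a\<in>UNIV. quarter_turn $ a $ b * mode_fun (pair_of a) p)"
    using pair_of_le_4[of b]
    by (simp add: p mode_fun_def rotation_def poly_legendre_minus_upto_4)
qed (simp add: modal_expansion_def)

lemma Q_entry_swap: "Q_entry q0 q1 q2 q3 q4 q5 {prod.swap a, prod.swap b} =
    Q_entry q0 q1 q2 q3 q4 q5 {a, b}"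
proof -
  \<comment> \<open>Moves the swap onto the literal sets in \<open>Q_entry\<close>; there it only
    permutes the alternatives within each branch.\<close>
  have eq: "prod.swap ` S = T \<longleftrightarrow> S = prod.swap ` T" for S T :: "(nat \<times> nat) set"
    by (auto simp: image_image)
  have "Q_entry q0 q1 q2 q3 q4 q5 (prod.swap ` S) = Q_entry q0 q1 q2 q3 q4 q5 S" for S
    by (simp add: Q_entry_def eq insert_commute disj_commute)
  from this[of "{a, b}"] show ?thesis by simp
qed

lemma Q_entry_parity:
  assumes "even (snd a) \<noteq> even (snd b)"
  shows "Q_entry q0 q1 q2 q3 q4 q5 {a, b} = 0"
  using assms Q_entry_support(2)[of q0 q1 q2 q3 q4 q5 "{a, b}"] by blast

text \<open>Each side has a single nonzero term, at the swap of \<open>a\<close> or of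
  \<open>b\<close>. Swap symmetry equates the two entries of Q; the signs agree unless the parities
  of the second components differ, and then the entry is 0.\<close>

lemma quarter_turn_commutes:
  "quarter_turn ** Q_matrix q0 q1 q2 q3 q4 q5 = Q_matrix q0 q1 q2 q3 q4 q5 ** quarter_turn"
proof -
  let ?q = "Q_entry q0 q1 q2 q3 q4 q5"
  have "(\<Sum>c\<in>UNIV. quarter_turn $ a $ c * ?q {pair_of c, pair_of b}) =
      (\<Sum>c\<in>UNIV. ?q {pair_of a, pair_of c} * quarter_turn $ c $ b)" for a b
  proof -
    obtain a' b' where sw: "pair_of a' = prod.swap (pair_of a)" "pair_of b' = prod.swap (pair_of b)"
      using ex_pair_of_swap by metis
    have "(\<Sum>c\<in>UNIV. quarter_turn $ a $ c * ?q {pair_of c, pair_of b}) =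
        (\<Sum>c\<in>UNIV. if c = a' then (-1) ^ snd (pair_of a) * ?q {pair_of a', pair_of b} else 0)"
      by (rule sum.cong) (use sw in \<open>auto simp: quarter_turn_def pair_of_inject[symmetric]\<close>)
    also have "\<dots> = (-1) ^ snd (pair_of a) * ?q {pair_of a', pair_of b}"
      by simp
    also have "\<dots> = (-1) ^ snd (pair_of a) * ?q {pair_of a, pair_of b'}"
      using Q_entry_swap[of q0 q1 q2 q3 q4 q5 "pair_of a" "pair_of b'"] by (simp add: sw)
    also have "\<dots> = ?q {pair_of a, pair_of b'} * (-1) ^ fst (pair_of b)"
      using Q_entry_parity[of "pair_of a" "pair_of b'"]
      by (cases "even (snd (pair_of a)) = even (snd (pair_of b'))") (auto simp: sw uminus_power_if)
    also have "\<dots> = (\<Sum>c\<in>UNIV. if c = b' then ?q {pair_of a, pair_of b'} * (-1) ^ fst (pair_of b) else 0)"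
      by simp
    also have "\<dots> = (\<Sum>c\<in>UNIV. ?q {pair_of a, pair_of c} * quarter_turn $ c $ b)"
      by (rule sum.cong) (use sw in \<open>auto simp: quarter_turn_def pair_of_inject[symmetric]\<close>)
    finally show ?thesis .
  qed
  then show ?thesis
    by (simp add: matrix_matrix_mult_def Q_matrix_def vec_eq_iff)
qed

lemma rotation_add: "rotation (\<theta> + \<phi>) = rotation \<theta> \<circ> rotation \<phi>"
  by (auto simp: rotation_def cos_add sin_add algebra_simps)

text \<open>Pulling back reverses the order: \<open>B\<close> acts first and gives
  \<open>p \<circ> g\<close>, then \<open>A\<close> appends \<open>f\<close>.\<close>

lemma represents_compose:
  assumes "represents A (\<lambda>p. p \<circ> f)" "represents B (\<lambda>p. p \<circ> g)"
  shows "represents (A ** B) (\<lambda>p. p \<circ> (g \<circ> f))"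
  using assms by (simp add: represents_def matrix_vector_mul_assoc[symmetric] comp_assoc)

text \<open>Representation and commutation are carried through the induction together, so the
  matrices of the half and three-quarter turns need not be computed.\<close>

lemma rot_matrix_multiple:
  fixes n :: nat
  shows "\<exists>A. represents A (\<lambda>p. p \<circ> rotation (real n * (pi / 2)))
    \<and> A ** Q_matrix q0 q1 q2 q3 q4 q5 = Q_matrix q0 q1 q2 q3 q4 q5 ** A"
proof (induction n)
  case 0
  have "rotation 0 = id" by (auto simp: rotation_def)
  then show ?case by (intro exI[of _ "mat 1"]) (simp add: represents_def)
next
  case (Suc n)
  then obtain A where A: "represents A (\<lambda>p. p \<circ> rotation (real n * (pi / 2)))"
    "A ** Q_matrix q0 q1 q2 q3 q4 q5 = Q_matrix q0 q1 q2 q3 q4 q5 ** A" by blast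
  have "real (Suc n) * (pi / 2) = pi / 2 + real n * (pi / 2)"
    by (simp add: algebra_simps)
  then have "represents (A ** quarter_turn) (\<lambda>p. p \<circ> rotation (real (Suc n) * (pi / 2)))"
    using represents_compose[OF A(1) represents_quarter_turn] by (simp only: rotation_add)
  moreover have "A ** quarter_turn ** Q_matrix q0 q1 q2 q3 q4 q5 =
      Q_matrix q0 q1 q2 q3 q4 q5 ** (A ** quarter_turn)"
    by (metis A(2) matrix_mul_assoc quarter_turn_commutes)
  ultimately show ?case by blast
qed

lemma rot_matrix_commutes:
  fixes m :: int
  shows "rot_matrix (of_int m * (pi / 2)) ** Q_matrix q0 q1 q2 q3 q4 q5 =
    Q_matrix q0 q1 q2 q3 q4 q5 ** rot_matrix (of_int m * (pi / 2))"
proof -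
  \<comment> \<open>Whole turns are the identity, so a possibly negative multiple reduces to one of
    0, 1, 2, 3.\<close>
  define n where "n = nat (m mod 4)"
  have "m = int n + 4 * (m div 4)" by (simp add: n_def)
  then have "(of_int m :: real) = real n + 4 * of_int (m div 4)"
    by (metis of_int_add of_int_mult of_int_numeral of_int_of_nat_eq)
  then have "of_int m * (pi / 2) = real n * (pi / 2) + of_int (m div 4) * (2 * pi)"
    by (simp add: algebra_simps)
  moreover have "rotation (of_int j * (2 * pi)) = id" for j :: int
    using cos_int_2pin[of j] sin_int_2pin[of j] by (auto simp: rotation_def mult_ac)
  ultimately have "rotation (of_int m * (pi / 2)) = rotation (real n * (pi / 2))"
    by (simp only: rotation_add comp_id)
  moreover obtain A where "represents A (\<lambda>p. p \<circ> rotation (real n * (pi / 2)))"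
    "A ** Q_matrix q0 q1 q2 q3 q4 q5 = Q_matrix q0 q1 q2 q3 q4 q5 ** A"
    using rot_matrix_multiple by blast
  ultimately show ?thesis
    by (simp add: rot_matrix_def matrix_of_eqI)
qed

section \<open>Positivity of the binary and ternary quadratic forms\<close>

lemma binary_form_pos_iff:
  fixes b q :: real
  shows "(\<forall>s t. (s, t) \<noteq> (0, 0) \<longrightarrow> b * s\<^sup>2 + b * t\<^sup>2 + 2 * q * s * t > 0) \<longleftrightarrow> b > 0 \<and> b\<^sup>2 - q\<^sup>2 > 0"
    (is "?L \<longleftrightarrow> ?R")
proof
  assume ?L
  then have b: "b > 0" using \<open>?L\<close>[rule_format, of 1 0] by simp
  \<comment> \<open>For fixed \<open>s\<close> the form is least at \<open>t = - q s / b\<close>;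
    the choice \<open>s = b\<close> clears the denominator.\<close>
  have "b * b\<^sup>2 + b * q\<^sup>2 + 2 * q * b * (-q) > 0"
    using \<open>?L\<close>[rule_format, of b "-q"] b by simp
  also have "b * b\<^sup>2 + b * q\<^sup>2 + 2 * q * b * (-q) = b * (b\<^sup>2 - q\<^sup>2)"
    by (simp add: algebra_simps power2_eq_square)
  finally show ?R using b by (simp add: zero_less_mult_iff)
next
  assume R: ?R
  show ?L
  proof (intro allI impI)
    fix s t :: real
    assume "(s, t) \<noteq> (0, 0)"
    then have "(b * s + q * t)\<^sup>2 + (b\<^sup>2 - q\<^sup>2) * t\<^sup>2 > 0"
      using R by (cases "t = 0") (auto intro: add_nonneg_pos)
    also have "(b * s + q * t)\<^sup>2 + (b\<^sup>2 - q\<^sup>2) * t\<^sup>2 = b * (b * s\<^sup>2 + b * t\<^sup>2 + 2 * q * s * t)"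
      by (simp add: algebra_simps power2_eq_square)
    finally show "b * s\<^sup>2 + b * t\<^sup>2 + 2 * q * s * t > 0"
      using R by (simp add: zero_less_mult_iff)
  qed
qed

text \<open>Sylvester's criterion in the variable order s, r, t. The determinant factors because
  exchanging \<open>s\<close> and \<open>t\<close> preserves the form, so that \<open>s - t\<close>
  decouples from \<open>s + t\<close> and \<open>r\<close>.\<close>

lemma ternary_form_pos_iff:
  fixes a c q h :: real
  shows "(\<forall>s t r. (s, t, r) \<noteq> (0, 0, 0) \<longrightarrow>
      a * s\<^sup>2 + a * t\<^sup>2 + c * r\<^sup>2 + 2 * q * (s + t) * r + 2 * h * s * t > 0)
    \<longleftrightarrow> a > 0 \<and> a * c - q\<^sup>2 > 0 \<and> (a - h) * ((a + h) * c - 2 * q\<^sup>2) > 0"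
    (is "?L \<longleftrightarrow> ?R")
proof
  assume L: ?L
  have a: "a > 0" using L[rule_format, of 1 0 0] by simp
  have c: "c > 0" using L[rule_format, of 0 0 1] by simp
  \<comment> \<open>The witness \<open>(c, 0, -q)\<close>, like \<open>(c, c, -2 q)\<close> below,
    has \<open>r = - q (s + t) / c\<close>, which minimises the form for given \<open>s\<close> and
    \<open>t\<close>.\<close>
  have "c * (a * c - q\<^sup>2) > 0"
    using L[rule_format, of c 0 "-q"] c by (simp add: algebra_simps power2_eq_square)
  then have 1: "a * c - q\<^sup>2 > 0" using c by (simp add: zero_less_mult_iff)
  have 2: "a - h > 0" using L[rule_format, of 1 "-1" 0] by simp
  have "(2 * c) * ((a + h) * c - 2 * q\<^sup>2) > 0"
    using L[rule_format, of c c "- 2 * q"] c by (simp add: algebra_simps power2_eq_square)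
  then have "(a + h) * c - 2 * q\<^sup>2 > 0" using c by (simp add: zero_less_mult_iff)
  with a 1 2 show ?R by simp
next
  assume R: ?R
  then have "a * c > 0" by (smt (verit) zero_le_power2)
  then have c: "c > 0" using R by (simp add: zero_less_mult_iff)
  \<comment> \<open>If both factors were negative, then \<open>(a + h) c < 2 q\<^sup>2 < 2 a c\<close>, so \<open>h < a\<close> after all.\<close>
  have 1: "a - h > 0"
  proof (rule ccontr)
    assume neg: "\<not> ?thesis"
    then have "(a + h) * c - 2 * q\<^sup>2 < 0"
      using R by (auto simp: zero_less_mult_iff)
    then have "(a + h) * c < (a + a) * c" using R by (simp add: algebra_simps)
    then show False using neg c by simp
  qed
  then have 2: "(a + h) * c - 2 * q\<^sup>2 > 0" using R by (simp add: zero_less_mult_iff)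
  show ?L
  proof (intro allI impI)
    fix s t r :: real
    assume nz: "(s, t, r) \<noteq> (0, 0, 0)"
    \<comment> \<open>This is \<open>2 c\<close> times the form, diagonalised by passing to
      \<open>s - t\<close> and \<open>s + t\<close> and completing the square in
      \<open>r\<close>.\<close>
    have "c * (a - h) * (s - t)\<^sup>2 + ((a + h) * c - 2 * q\<^sup>2) * (s + t)\<^sup>2 + 2 * (c * r + q * (s + t))\<^sup>2 > 0"
    proof (cases "s + t = 0")
      case True
      then show ?thesis using nz c 1
        by (cases "s = t") (auto intro: add_pos_nonneg)
    next
      case False
      then show ?thesis using c 1 2 by (intro add_pos_nonneg add_nonneg_pos) auto
    qed
    also have "\<dots> = (2 * c) * (a * s\<^sup>2 + a * t\<^sup>2 + c * r\<^sup>2 + 2 * q * (s + t) * r + 2 * h * s * t)"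
      by (simp add: algebra_simps power2_eq_square)
    finally show "a * s\<^sup>2 + a * t\<^sup>2 + c * r\<^sup>2 + 2 * q * (s + t) * r + 2 * h * s * t > 0"
      using c by (simp add: zero_less_mult_iff)
  qed
qed

section \<open>The quadratic form of M + Q and its blocks\<close>

definition degree_4_pairs :: "(nat \<times> nat) set" where
  "degree_4_pairs = {(0, 4), (1, 3), (2, 2), (3, 1), (4, 0)}"

lemma degree_4_pairs_iff: "a \<in> degree_4_pairs \<longleftrightarrow> fst a + snd a = 4"
  by (cases a) (auto simp: degree_4_pairs_def)

text \<open>Modes of degree at most 3 meet only the diagonal mass matrix. The constants 4/9, 4/25
  and 4/21 are the mass entries at (0,4), (2,2) and (1,3), and Q does not couple {(0,4), (2,2),
  (4,0)} with {(1,3), (3,1)}.\<close>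

lemma quadratic_form_eq:
  fixes x :: "real ^ idx4"
  defines "y \<equiv> (\<lambda>v w. x $ Idx4 (v, w))"
  shows "x \<bullet> ((mass_matrix + Q_matrix q0 q1 q2 q3 q4 q5) *v x) =
    (\<Sum>(v, w)\<in>total_order_index 3. 4 / ((2 * real v + 1) * (2 * real w + 1)) * (y v w)\<^sup>2)
    + ((4/9 + q0) * (y 0 4)\<^sup>2 + (4/9 + q0) * (y 4 0)\<^sup>2 + (4/25 + q2) * (y 2 2)\<^sup>2
       + 2 * q3 * (y 0 4 + y 4 0) * y 2 2 + 2 * q5 * y 0 4 * y 4 0)
    + ((4/21 + q1) * (y 1 3)\<^sup>2 + (4/21 + q1) * (y 3 1)\<^sup>2 + 2 * q4 * y 1 3 * y 3 1)"
proof -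
  let ?q = "Q_entry q0 q1 q2 q3 q4 q5"
  let ?I = "total_order_index 4"
  define z where "z = (\<lambda>p. x $ Idx4 p)"
  define M where "M = (\<lambda>(v, w). 4 / ((2 * real v + 1) * (2 * real w + 1)) * (z (v, w))\<^sup>2)"
  have z: "x $ a = z (pair_of a)" for a by (simp add: z_def pair_of_inverse)
  have split: "?I = total_order_index 3 \<union> degree_4_pairs" "total_order_index 3 \<inter> degree_4_pairs = {}"
    by (auto simp: degree_4_pairs_iff total_order_index_def)
  have fin: "finite degree_4_pairs" by (simp add: degree_4_pairs_def)
  have mass: "x \<bullet> (mass_matrix *v x) = sum M (total_order_index 3) + sum M degree_4_pairs"
  proof -
    have "x \<bullet> (mass_matrix *v x) = (\<Sum>a\<in>UNIV. M (pair_of a))"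
      by (auto simp: inner_vec_def matrix_vector_mult_def mass_matrix_nth M_def z power2_eq_square
          if_distrib[of "\<lambda>t. t * _"] split: prod.splits cong: if_cong intro!: sum.cong)
    also have "\<dots> = sum M ?I" by (rule sum_pair_of)
    finally show ?thesis
      using split fin finite_total_order_index by (simp add: sum.union_disjoint)
  qed
  have "x \<bullet> (Q_matrix q0 q1 q2 q3 q4 q5 *v x) =
      (\<Sum>a\<in>UNIV. \<Sum>b\<in>UNIV. z (pair_of a) * (?q {pair_of a, pair_of b} * z (pair_of b)))"
    by (simp add: inner_vec_def matrix_vector_mult_def Q_matrix_def z sum_distrib_left)
  also have "\<dots> = (\<Sum>a\<in>?I. \<Sum>b\<in>?I. z a * (?q {a, b} * z b))"
    by (simp add: sum_pair_of[of "\<lambda>b. z _ * (?q {_, b} * z b)"]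
        sum_pair_of[of "\<lambda>a. \<Sum>b\<in>?I. z a * (?q {a, b} * z b)"])
  also have "\<dots> = (\<Sum>a\<in>degree_4_pairs. \<Sum>b\<in>?I. z a * (?q {a, b} * z b))"
    by (intro sum.mono_neutral_right finite_total_order_index)
      (auto simp: split(1) degree_4_pairs_iff Q_entry_eq_0)
  also have "\<dots> = (\<Sum>a\<in>degree_4_pairs. \<Sum>b\<in>degree_4_pairs. z a * (?q {a, b} * z b))"
    by (intro sum.cong refl sum.mono_neutral_right finite_total_order_index)
      (auto simp: split(1) degree_4_pairs_iff Q_entry_eq_0)
  finally have Q: "x \<bullet> (Q_matrix q0 q1 q2 q3 q4 q5 *v x) =
      (\<Sum>a\<in>degree_4_pairs. \<Sum>b\<in>degree_4_pairs. z a * (?q {a, b} * z b))" .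
  have "sum M degree_4_pairs + (\<Sum>a\<in>degree_4_pairs. \<Sum>b\<in>degree_4_pairs. z a * (?q {a, b} * z b)) =
    ((4/9 + q0) * (y 0 4)\<^sup>2 + (4/9 + q0) * (y 4 0)\<^sup>2 + (4/25 + q2) * (y 2 2)\<^sup>2
       + 2 * q3 * (y 0 4 + y 4 0) * y 2 2 + 2 * q5 * y 0 4 * y 4 0)
    + ((4/21 + q1) * (y 1 3)\<^sup>2 + (4/21 + q1) * (y 3 1)\<^sup>2 + 2 * q4 * y 1 3 * y 3 1)"
    unfolding degree_4_pairs_def M_def
    by (simp add: Q_entry_def doubleton_eq_iff y_def z_def)
      (simp add: algebra_simps power2_eq_square)
  then show ?thesis
    by (simp add: matrix_vector_mult_add_rdistrib inner_add_right mass Q)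
      (simp add: M_def y_def z_def)
qed

lemma transpose_mass_plus_Q:
  "transpose (mass_matrix + Q_matrix q0 q1 q2 q3 q4 q5) = mass_matrix + Q_matrix q0 q1 q2 q3 q4 q5"
  by (auto simp: transpose_def vec_eq_iff mass_matrix_nth Q_matrix_def insert_commute)

lemma positive_definite_iff_blocks:
  "positive_definite (mass_matrix + Q_matrix q0 q1 q2 q3 q4 q5) \<longleftrightarrow>
    (\<forall>s t r. (s, t, r) \<noteq> (0, 0, 0) \<longrightarrow> (4/9 + q0) * s\<^sup>2 + (4/9 + q0) * t\<^sup>2 + (4/25 + q2) * r\<^sup>2
       + 2 * q3 * (s + t) * r + 2 * q5 * s * t > 0)
    \<and> (\<forall>s t. (s, t) \<noteq> (0, 0) \<longrightarrow> (4/21 + q1) * s\<^sup>2 + (4/21 + q1) * t\<^sup>2 + 2 * q4 * s * t > 0)"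
  (is "_ \<longleftrightarrow> (\<forall>s t r. _ \<longrightarrow> ?F3 s t r > 0) \<and> (\<forall>s t. _ \<longrightarrow> ?F2 s t > 0)")
proof -
  let ?A = "mass_matrix + Q_matrix q0 q1 q2 q3 q4 q5"
  define S where "S = (\<lambda>x :: real ^ idx4. \<Sum>(v, w)\<in>total_order_index 3.
    4 / ((2 * real v + 1) * (2 * real w + 1)) * (x $ Idx4 (v, w))\<^sup>2)"
  have form: "x \<bullet> (?A *v x) = S x
      + ?F3 (x $ Idx4 (0, 4)) (x $ Idx4 (4, 0)) (x $ Idx4 (2, 2))
      + ?F2 (x $ Idx4 (1, 3)) (x $ Idx4 (3, 1))" for x
    unfolding S_def by (rule quadratic_form_eq)
  show ?thesis
  proof (intro iffI conjI allI impI)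
    assume pd: "positive_definite ?A"
    \<comment> \<open>Test vectors are prescribed on index pairs and supported on one block, so that
      \<open>S\<close> and the other block contribute 0.\<close>
    define X where "X = (\<lambda>f. (\<chi> a. f (pair_of a)) :: real ^ idx4)"
    have X: "X f $ Idx4 p = f p" if "fst p + snd p \<le> 4" for f p
      using that by (cases p) (simp add: X_def Idx4_inverse total_order_index_def)
    have S0: "S (X f) = 0" if "\<And>p. fst p + snd p \<le> 3 \<Longrightarrow> f p = 0" for f
      unfolding S_def using that by (auto intro!: sum.neutral simp: X total_order_index_def)
    {
      fix s t r :: real
      assume nz: "(s, t, r) \<noteq> (0, 0, 0)"
      let ?x = "X (\<lambda>p. if p = (0, 4) then s else if p = (4, 0) then t else if p = (2, 2) then r else 0)"
      have "?x $ Idx4 (0, 4) = s" "?x $ Idx4 (4, 0) = t" "?x $ Idx4 (2, 2) = r"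
        "?x $ Idx4 (1, 3) = 0" "?x $ Idx4 (3, 1) = 0" "S ?x = 0"
        by (auto simp: X intro!: S0)
      note x = this
      then have "?x \<noteq> 0" using nz by auto
      then have "?x \<bullet> (?A *v ?x) > 0" using pd unfolding positive_definite_def by blast
      then show "?F3 s t r > 0" unfolding form x by simp
    next
      fix s t :: real
      assume nz: "(s, t) \<noteq> (0, 0)"
      let ?x = "X (\<lambda>p. if p = (1, 3) then s else if p = (3, 1) then t else 0)"
      have "?x $ Idx4 (0, 4) = 0" "?x $ Idx4 (4, 0) = 0" "?x $ Idx4 (2, 2) = 0"
        "?x $ Idx4 (1, 3) = s" "?x $ Idx4 (3, 1) = t" "S ?x = 0"
        by (auto simp: X intro!: S0)
      note x = this
      then have "?x \<noteq> 0" using nz by auto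
      then have "?x \<bullet> (?A *v ?x) > 0" using pd unfolding positive_definite_def by blast
      then show "?F2 s t > 0" unfolding form x by simp
    }
  next
    assume blocks: "(\<forall>s t r. (s, t, r) \<noteq> (0, 0, 0) \<longrightarrow> ?F3 s t r > 0)
      \<and> (\<forall>s t. (s, t) \<noteq> (0, 0) \<longrightarrow> ?F2 s t > 0)"
    then have B3: "?F3 s t r > 0" if "(s, t, r) \<noteq> (0, 0, 0)" for s t r using that by blast
    from blocks have B2: "?F2 s t > 0" if "(s, t) \<noteq> (0, 0)" for s t using that by blast
    \<comment> \<open>Conversely, all three summands are nonnegative, and the one that contains a
      nonzero coordinate is strictly positive.\<close>
    have F3: "?F3 s t r \<ge> 0" for s t r
    proof (cases "(s, t, r) = (0, 0, 0)")
      case False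
      then show ?thesis by (rule less_imp_le[OF B3])
    qed simp
    have F2: "?F2 s t \<ge> 0" for s t
    proof (cases "(s, t) = (0, 0)")
      case False
      then show ?thesis by (rule less_imp_le[OF B2])
    qed simp
    have "x \<bullet> (?A *v x) > 0" if "x \<noteq> 0" for x :: "real ^ idx4"
    proof -
      obtain a where a: "x $ a \<noteq> 0" using \<open>x \<noteq> 0\<close> by (auto simp: vec_eq_iff)
      then have a': "x $ Idx4 (pair_of a) \<noteq> 0" by (simp add: pair_of_inverse)
      have S: "S x \<ge> 0" unfolding S_def by (intro sum_nonneg) auto
      have "pair_of a \<in> total_order_index 3 \<or> pair_of a \<in> degree_4_pairs"
        using pair_of_le_4(3)[of a]
        by (cases "pair_of a") (auto simp: total_order_index_def degree_4_pairs_iff)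
      then show ?thesis
      proof
        assume in3: "pair_of a \<in> total_order_index 3"
        have "S x > 0" unfolding S_def
          by (rule sum_pos2[OF finite_total_order_index in3]) (use a' in \<open>auto split: prod.splits\<close>)
        then show ?thesis
          unfolding form by (rule add_pos_nonneg[OF add_pos_nonneg[OF _ F3] F2])
      next
        assume "pair_of a \<in> degree_4_pairs"
        then have "(x $ Idx4 (0, 4), x $ Idx4 (4, 0), x $ Idx4 (2, 2)) \<noteq> (0, 0, 0)
            \<or> (x $ Idx4 (1, 3), x $ Idx4 (3, 1)) \<noteq> (0, 0)"
          using a' unfolding degree_4_pairs_def by auto
        then show ?thesis
        proof
          assume "(x $ Idx4 (0, 4), x $ Idx4 (4, 0), x $ Idx4 (2, 2)) \<noteq> (0, 0, 0)"
          then show ?thesis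
            unfolding form by (rule add_pos_nonneg[OF add_nonneg_pos[OF S B3] F2])
        next
          assume "(x $ Idx4 (1, 3), x $ Idx4 (3, 1)) \<noteq> (0, 0)"
          then show ?thesis
            unfolding form by (rule add_nonneg_pos[OF add_nonneg_nonneg[OF S F3] B2])
        qed
      qed
    qed
    then show "positive_definite ?A"
      by (simp add: positive_definite_def transpose_mass_plus_Q)
  qed
qed

theorem mainTheorem6:
  fixes q0 q1 q2 q3 q4 q5 :: real
  defines "Q \<equiv> Q_matrix q0 q1 q2 q3 q4 q5"
  shows "Q ** Dx = - transpose (Q ** Dx)
    \<and> Q ** Dy = - transpose (Q ** Dy)
    \<and> (\<forall>m :: int. rot_matrix (of_int m * (pi / 2)) ** Q = Q ** rot_matrix (of_int m * (pi / 2)))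
    \<and> (positive_definite (mass_matrix + Q) \<longleftrightarrow>
          q0 > - 4 / 9
        \<and> q1 > - 4 / 21
        \<and> 36 * q0 + 225 * q0 * q2 + 100 * q2 - 225 * q3\<^sup>2 + 16 > 0
        \<and> (21 * q1 + 4)\<^sup>2 - 441 * q4\<^sup>2 > 0
        \<and> (9 * q0 - 9 * q5 + 4)
            * (9 * q0 * (25 * q2 + 4) + 25 * q2 * (9 * q5 + 4)
               + 2 * (- 225 * q3\<^sup>2 + 18 * q5 + 8)) > 0)"
proof -
  \<comment> \<open>Both products with derivative matrices are 0, so skew-symmetry is a statement
    about the zero matrix.\<close>
  have "transpose (0 :: real ^ idx4 ^ idx4) = 0"
    by (simp add: transpose_def vec_eq_iff)
  moreover have "q0 > - 4 / 9 \<longleftrightarrow> 4/9 + q0 > 0" "q1 > - 4 / 21 \<longleftrightarrow> 4/21 + q1 > 0"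
    by auto
  \<comment> \<open>The stated polynomials are the block minors with denominators cleared: 225 = 9 *
    25, 441 = 21 * 21 and 2025 = 9 * 225.\<close>
  moreover have "36 * q0 + 225 * q0 * q2 + 100 * q2 - 225 * q3\<^sup>2 + 16 =
      225 * ((4/9 + q0) * (4/25 + q2) - q3\<^sup>2)"
    by (simp add: algebra_simps)
  moreover have "(21 * q1 + 4)\<^sup>2 - 441 * q4\<^sup>2 = 441 * ((4/21 + q1)\<^sup>2 - q4\<^sup>2)"
    by (simp add: algebra_simps power2_eq_square)
  moreover have "(9 * q0 - 9 * q5 + 4)
      * (9 * q0 * (25 * q2 + 4) + 25 * q2 * (9 * q5 + 4) + 2 * (- 225 * q3\<^sup>2 + 18 * q5 + 8)) =
      2025 * ((4/9 + q0 - q5) * ((4/9 + q0 + q5) * (4/25 + q2) - 2 * q3\<^sup>2))"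
    by (simp add: field_simps power2_eq_square)
  moreover have "225 * t > 0 \<longleftrightarrow> t > 0" "441 * t > 0 \<longleftrightarrow> t > 0" "2025 * t > 0 \<longleftrightarrow> t > 0" for t :: real
    by auto
  ultimately show ?thesis
    unfolding Q_def
    \<comment> \<open>The criteria arrive grouped by block, whereas the statement interleaves them;
      \<open>conj_ac\<close> reorders.\<close>
    by (simp only: Q_mult_Dx Q_mult_Dy rot_matrix_commutes positive_definite_iff_blocks
        ternary_form_pos_iff binary_form_pos_iff minus_zero conj_ac simp_thms)
qed

end
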